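(* Let $s\in[0,1]$. For any $Y\in 2^\omega$ there is some $X\in 2^\omega$ such that $\dim(X)\le s$ and $d(X,Y)\le H^{-1}(1-s)$.
   Context: $2^\omega$ is the space of infinite binary sequences and $Z\upharpoonright_n$ is the $n$-bit prefix of $Z$. $K$ denotes prefix-free Kolmogorov complexity. The effective Hausdorff dimension of $X\in 2^\omega$ is $\dim(X)=\liminf_{n\to\infty} K(X\upharpoonright_n)/n$. For $n\ge 1$ and $\sigma,\tau\in\{0,1\}^n$, $d(\sigma,\tau)=\#\{k:\sigma(k)\ne\tau(k)\}/n$; for $X,Y\in 2^\omega$, $d(X,Y)=\limsup_{n\to\infty} d(X\upharpoonright_n,Y\upharpoonright_n)$. $H(p)=-(p\log_2 p+(1-p)\log_2(1-p))$ is the binary entropy function on $[0,1]$ (with $H(0)=H(1)=0$), and $H^{-1}:[0,1]\to[0,1/2]$ is the inverse of the restriction of $H$ to $[0,1/2]$. *)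

theory Defs
  imports Complex_Main "HOL-Library.Extended_Real" "HOL-Library.Liminf_Limsup" "HOL-Library.Sublist"
begin

text \<open>Kleene's partial recursive functions, given by a big-step evaluation relation:
  \<open>computes f xs y\<close> means that \<open>f\<close> halts on the argument tuple \<open>xs\<close> with value \<open>y\<close>.\<close>

datatype recf = Zero | Succ | Proj nat | Comp recf "recf list" | PrimRec recf recf | Mu recf

inductive computes :: "recf \<Rightarrow> nat list \<Rightarrow> nat \<Rightarrow> bool" where
  zero: "computes Zero xs 0"
| succ: "computes Succ [x] (Suc x)"
| proj: "i < length xs \<Longrightarrow> computes (Proj i) xs (xs ! i)"
| comp: "list_all2 (\<lambda>g z. computes g xs z) gs zs \<Longrightarrow> computes f zs y \<Longrightarrow> computes (Comp f gs) xs y"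
| primrec_0: "computes f xs y \<Longrightarrow> computes (PrimRec f g) (0 # xs) y"
| primrec_Suc: "computes (PrimRec f g) (n # xs) z \<Longrightarrow> computes g (n # z # xs) y
    \<Longrightarrow> computes (PrimRec f g) (Suc n # xs) y"
| mu: "computes f (y # xs) 0 \<Longrightarrow> (\<And>z. z < y \<Longrightarrow> \<exists>v. 0 < v \<and> computes f (z # xs) v)
    \<Longrightarrow> computes (Mu f) xs y"

lemma computes_functional: "computes f xs y \<Longrightarrow> computes f xs z \<Longrightarrow> y = z"
proof (induction arbitrary: z rule: computes.induct)
  case (zero xs) then show ?case by cases auto
next
  case (succ x) then show ?case by cases auto
next
  case (proj i xs) from proj(2) show ?case by cases auto
next
  case (comp xs gs zs f y)
  from comp.prems obtain zs' where *: "list_all2 (\<lambda>g z. computes g xs z) gs zs'" "computes f zs' z"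
    by cases auto
  have "zs = zs'"
    using comp.IH(1) *(1) by (auto simp: list_all2_conv_all_nth intro!: nth_equalityI)
  with *(2) comp.IH(2) show ?case by blast
next
  case (primrec_0 f xs y g) from primrec_0.prems primrec_0.IH show ?case by cases auto
next
  case (primrec_Suc f g n xs w y)
  from primrec_Suc.prems obtain w' where "computes (PrimRec f g) (n # xs) w'" "computes g (n # w' # xs) z"
    by cases auto
  with primrec_Suc.IH show ?case by blast
next
  case (mu f y xs)
  from mu.prems have *: "computes f (z # xs) 0" "\<And>u. u < z \<Longrightarrow> \<exists>v. 0 < v \<and> computes f (u # xs) v"
    by (cases; blast)+
  show ?case
  proof (cases y z rule: linorder_cases)
    case less
    with *(2) mu.IH(1) show ?thesis by fastforce
  next
    case greater
    with *(1) mu.IH(2) show ?thesis by fastforce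
  qed
qed

text \<open>Bijective base-2 numeration, least significant digit first.\<close>

fun string_code :: "bool list \<Rightarrow> nat" where
  "string_code [] = 0"
| "string_code (b # w) = 2 * string_code w + (if b then 2 else 1)"

lemma bij_string_code: "bij string_code"
proof (rule bijI)
  show "inj string_code"
  proof (rule injI)
    fix v w show "string_code v = string_code w \<Longrightarrow> v = w"
    proof (induction v arbitrary: w)
      case Nil then show ?case by (cases w) (auto split: if_splits)
    next
      case (Cons b v)
      from Cons.prems obtain c u where w: "w = c # u" by (cases w) (auto split: if_splits)
      have "b = c \<and> string_code v = string_code u"
        using Cons.prems unfolding w by (cases b; cases c) (simp_all; presburger)+
      with Cons.IH w show ?case by blast
    qed
  qed
  have "\<exists>w. n = string_code w" for n
  proof (induction n rule: less_induct)
    case (less n)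
    have "n = 0 \<or> n = 2 * ((n - 1) div 2) + 1 \<or> n = 2 * ((n - 1) div 2) + 2" by presburger
    then consider "n = 0" | m where "n = 2 * m + 1" | m where "n = 2 * m + 2" by metis
    then show ?case
    proof cases
      case 1 then show ?thesis by (intro exI[of _ "[]"]) simp
    next
      case (2 m) then obtain w where "m = string_code w" using less[of m] by auto
      with 2 show ?thesis by (intro exI[of _ "False # w"]) simp
    next
      case (3 m) then obtain w where "m = string_code w" using less[of m] by auto
      with 3 show ?thesis by (intro exI[of _ "True # w"]) simp
    qed
  qed
  then show "surj string_code" by (simp add: surj_def)
qed

definition partial_computable :: "(bool list \<Rightarrow> bool list option) \<Rightarrow> bool" where
  "partial_computable M \<longleftrightarrow>
     (\<exists>f. \<forall>p w. M p = Some w \<longleftrightarrow> computes f [string_code p] (string_code w))"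

definition prefix_free_machine :: "(bool list \<Rightarrow> bool list option) \<Rightarrow> bool" where
  "prefix_free_machine M \<longleftrightarrow> partial_computable M \<and>
     (\<forall>p \<in> dom M. \<forall>q \<in> dom M. prefix p q \<longrightarrow> p = q)"

text \<open>Shortest description length with respect to \<open>M\<close>; it is \<open>\<infinity>\<close> if there is no description.\<close>

definition complexity :: "(bool list \<Rightarrow> bool list option) \<Rightarrow> bool list \<Rightarrow> enat" where
  "complexity M w = (INF p \<in> {p. M p = Some w}. enat (length p))"

text \<open>Prefix-free Kolmogorov complexity \<open>K\<close> is \<open>complexity U\<close> for an optimal prefix-free
  machine \<open>U\<close>. Different choices of \<open>U\<close> change \<open>K\<close> by at most an additive constant,
  which does not affect the effective dimension.\<close>

definition optimal_prefix_free_machine :: "(bool list \<Rightarrow> bool list option) \<Rightarrow> bool" where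
  "optimal_prefix_free_machine U \<longleftrightarrow> prefix_free_machine U \<and>
     (\<forall>M. prefix_free_machine M \<longrightarrow>
        (\<exists>c::nat. \<forall>w. complexity U w \<le> complexity M w + enat c))"

definition initial_segment :: "(nat \<Rightarrow> bool) \<Rightarrow> nat \<Rightarrow> bool list" where
  "initial_segment X n = map X [0..<n]"

definition effective_dim :: "(bool list \<Rightarrow> bool list option) \<Rightarrow> (nat \<Rightarrow> bool) \<Rightarrow> ereal" where
  "effective_dim U X =
     liminf (\<lambda>n. ereal_of_enat (complexity U (initial_segment X n)) / ereal (real n))"

text \<open>Normalized Hamming distance, for strings of the same positive length.\<close>

definition hamming_dist :: "bool list \<Rightarrow> bool list \<Rightarrow> real" where
  "hamming_dist v w = real (card {k. k < length v \<and> v ! k \<noteq> w ! k}) / real (length v)"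

definition seq_dist :: "(nat \<Rightarrow> bool) \<Rightarrow> (nat \<Rightarrow> bool) \<Rightarrow> ereal" where
  "seq_dist X Y =
     limsup (\<lambda>n. ereal (hamming_dist (initial_segment X n) (initial_segment Y n)))"

definition binary_entropy :: "real \<Rightarrow> real" where
  "binary_entropy p = - (p * log 2 p + (1 - p) * log 2 (1 - p))"

lemma binary_entropy_0: "binary_entropy 0 = 0" and binary_entropy_1: "binary_entropy 1 = 0"
  by (simp_all add: binary_entropy_def)

definition inv_binary_entropy :: "real \<Rightarrow> real" where
  "inv_binary_entropy = the_inv_into {0..1/2} binary_entropy"

end

theory Submission
  imports Defs "HOL-Real_Asymp.Real_Asymp"
begin

text \<open>
  The sequence \<open>X\<close> arises from \<open>Y\<close> by lossy compression. Let \<open>r\<close> be the radius with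
  \<open>binary_entropy r = 1 - s\<close>, \<open>0 \<le> r \<le> 1/2\<close>. A Hamming sphere of radius about \<open>r * m\<close> in
  \<open>{0,1}\<^sup>m\<close> has \<open>2\<close> to the power \<open>(1 - s) * m - o(m)\<close> points (\<open>binomial_entropy_lower_bound\<close>),
  so a greedy choice of centres covers all words of length \<open>m\<close> with about
  \<open>2\<close> to the power \<open>s * m + o(m)\<close> codewords (\<open>good_covering_code\<close>). Replacing each block of
  \<open>Y\<close> of length \<open>m\<close> by the codeword whose sphere contains it costs at most \<open>r * m\<close> errors per
  block, and the codeword is named by a little over \<open>s * m\<close> bits.

  With one fixed \<open>m\<close> the rate is only \<open>s + \<epsilon>\<close>, so the block length must grow. The sequence
  is therefore built in stages: stage \<open>k\<close> uses one code of rate close to \<open>s\<close>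
  and appends very many of its codewords to the string \<open>\<sigma>\<close> reached so far. The code and \<open>\<sigma>\<close>
  are finite objects, so they can be built into a prefix-free machine whose input is just
  the list of block names, each preceded by a continuation bit. Passing to the optimal machine
  costs a constant that may depend on \<open>k\<close> and \<open>\<sigma>\<close> in any way whatever, because the stage is
  continued until this constant is negligible (\<open>complexity_block_code\<close>, \<open>extension_stage\<close>). At
  the ends of the stages the complexity per bit is thus at most \<open>s\<close> plus an error that tends to
  \<open>0\<close>, and these infinitely many prefixes bound the lower limit.

  For the distance every prefix matters. A prefix of length \<open>n\<close> consists of complete blocks,
  with an error rate of at most \<open>r\<close>, and one partial block. Stage \<open>k\<close> starts only after \<open>k\<close> times
  its block length has been reached, so the partial block contributes at most \<open>1 / k\<close>.
\<close>

section \<open>Recursive functions\<close>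

definition recursive1 :: "(nat \<Rightarrow> nat) \<Rightarrow> bool" where
  "recursive1 f \<longleftrightarrow> (\<exists>r. \<forall>x. computes r [x] (f x))"

definition recursive2 :: "(nat \<Rightarrow> nat \<Rightarrow> nat) \<Rightarrow> bool" where
  "recursive2 f \<longleftrightarrow> (\<exists>r. \<forall>x y. computes r [x, y] (f x y))"

definition recursive3 :: "(nat \<Rightarrow> nat \<Rightarrow> nat \<Rightarrow> nat) \<Rightarrow> bool" where
  "recursive3 f \<longleftrightarrow> (\<exists>r. \<forall>x y z. computes r [x, y, z] (f x y z))"

lemma computes_proj: "i < length xs \<Longrightarrow> y = xs ! i \<Longrightarrow> computes (Proj i) xs y"
  by (simp add: computes.proj)

lemma computes_const: "\<exists>r. \<forall>xs. computes r xs c"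
proof (induction c)
  case 0
  show ?case by (blast intro: computes.zero)
next
  case (Suc c)
  then obtain r where "\<forall>xs. computes r xs c" by blast
  then have "\<forall>xs. computes (Comp Succ [r]) xs (Suc c)"
    by (auto intro!: computes.comp[where zs = "[c]"] computes.succ)
  then show ?case by blast
qed

lemma recursive1_id: "recursive1 (\<lambda>x. x)"
  unfolding recursive1_def by (rule exI[of _ "Proj 0"]) (simp add: computes_proj)

lemma recursive2_fst: "recursive2 (\<lambda>x y. x)"
  unfolding recursive2_def by (rule exI[of _ "Proj 0"]) (simp add: computes_proj)

lemma recursive2_snd: "recursive2 (\<lambda>x y. y)"
  unfolding recursive2_def by (rule exI[of _ "Proj 1"]) (simp add: computes_proj)

lemma recursive3_proj:
  "recursive3 (\<lambda>x y z. x)" "recursive3 (\<lambda>x y z. y)" "recursive3 (\<lambda>x y z. z)"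
  unfolding recursive3_def
  by (rule exI[of _ "Proj 0"] exI[of _ "Proj 1"] exI[of _ "Proj 2"], simp add: computes_proj)+

lemma recursive_const:
  "recursive1 (\<lambda>x. c)" "recursive2 (\<lambda>x y. c)" "recursive3 (\<lambda>x y z. c)"
  unfolding recursive1_def recursive2_def recursive3_def using computes_const[of c] by blast+

lemma recursive1_Suc: "recursive1 Suc"
  unfolding recursive1_def by (blast intro: computes.succ)

lemma recursive_comp1:
  assumes "recursive1 h"
  shows "recursive1 f \<Longrightarrow> recursive1 (\<lambda>x. h (f x))"
    and "recursive2 g \<Longrightarrow> recursive2 (\<lambda>x y. h (g x y))"
    and "recursive3 k \<Longrightarrow> recursive3 (\<lambda>x y z. h (k x y z))"
proof -
  obtain r where r: "\<And>x. computes r [x] (h x)"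
    using assms unfolding recursive1_def by blast
  have *: "computes (Comp r [q]) xs (h v)" if "computes q xs v" for q xs v
    using that r by (auto intro!: computes.comp[where zs = "[v]"])
  show "recursive1 f \<Longrightarrow> recursive1 (\<lambda>x. h (f x))"
    "recursive2 g \<Longrightarrow> recursive2 (\<lambda>x y. h (g x y))"
    "recursive3 k \<Longrightarrow> recursive3 (\<lambda>x y z. h (k x y z))"
    unfolding recursive1_def recursive2_def recursive3_def using * by meson+
qed

lemma recursive_comp2:
  assumes "recursive2 h"
  shows "recursive1 f \<Longrightarrow> recursive1 f' \<Longrightarrow> recursive1 (\<lambda>x. h (f x) (f' x))"
    and "recursive2 g \<Longrightarrow> recursive2 g' \<Longrightarrow> recursive2 (\<lambda>x y. h (g x y) (g' x y))"
    and "recursive3 k \<Longrightarrow> recursive3 k' \<Longrightarrow> recursive3 (\<lambda>x y z. h (k x y z) (k' x y z))"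
proof -
  obtain r where r: "\<And>x y. computes r [x, y] (h x y)"
    using assms unfolding recursive2_def by blast
  have *: "computes (Comp r [q, q']) xs (h v v')" if "computes q xs v" "computes q' xs v'"
    for q q' xs v v'
    using that r by (auto intro!: computes.comp[where zs = "[v, v']"])
  show "recursive1 f \<Longrightarrow> recursive1 f' \<Longrightarrow> recursive1 (\<lambda>x. h (f x) (f' x))"
    "recursive2 g \<Longrightarrow> recursive2 g' \<Longrightarrow> recursive2 (\<lambda>x y. h (g x y) (g' x y))"
    "recursive3 k \<Longrightarrow> recursive3 k' \<Longrightarrow> recursive3 (\<lambda>x y z. h (k x y z) (k' x y z))"
    unfolding recursive1_def recursive2_def recursive3_def using * by meson+
qed

lemma recursive1_primrec:
  assumes g: "recursive2 g" and "h 0 = a" and "\<And>n. h (Suc n) = g n (h n)"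
  shows "recursive1 h"
proof -
  obtain ra where ra: "computes ra [] a" using computes_const by blast
  obtain rg where rg: "\<And>x y. computes rg [x, y] (g x y)" using g unfolding recursive2_def by blast
  have "computes (PrimRec ra rg) [n] (h n)" for n
    by (induction n) (auto simp: assms(2,3) intro: computes.intros ra rg)
  then show ?thesis unfolding recursive1_def by blast
qed

lemma recursive2_primrec:
  assumes f: "recursive1 f" and g: "recursive3 g"
    and "\<And>x. h 0 x = f x" and "\<And>n x. h (Suc n) x = g n (h n x) x"
  shows "recursive2 h"
proof -
  obtain rf where rf: "\<And>x. computes rf [x] (f x)" using f unfolding recursive1_def by blast
  obtain rg where rg: "\<And>x y z. computes rg [x, y, z] (g x y z)"
    using g unfolding recursive3_def by blast
  have "computes (PrimRec rf rg) [n, x] (h n x)" for n x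
    by (induction n) (auto simp: assms(3,4) intro: computes.intros rf rg)
  then show ?thesis unfolding recursive2_def by blast
qed

lemma recursive2_plus: "recursive2 (+)"
  by (rule recursive2_primrec[OF recursive1_id recursive_comp1(3)[OF recursive1_Suc recursive3_proj(2)]])
     simp_all

lemmas recursive_plus = recursive_comp2[OF recursive2_plus]

lemma recursive2_times: "recursive2 (*)"
  by (rule recursive2_primrec[OF recursive_const(1)[of 0]
        recursive_plus(3)[OF recursive3_proj(2) recursive3_proj(3)]]) simp_all

lemmas recursive_times = recursive_comp2[OF recursive2_times]

lemma recursive1_pred: "recursive1 (\<lambda>n. n - 1)"
  by (rule recursive1_primrec[OF recursive2_fst, where a = 0]) simp_all

lemma recursive2_minus: "recursive2 (-)"
proof -
  have "recursive2 (\<lambda>n x. x - n)"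
    by (rule recursive2_primrec[OF recursive1_id
          recursive_comp1(3)[OF recursive1_pred recursive3_proj(2)]]) simp_all
  then show ?thesis
    by (rule recursive_comp2(2)[OF _ recursive2_snd recursive2_fst])
qed

lemmas recursive_minus = recursive_comp2[OF recursive2_minus]

lemma recursive1_mod2: "recursive1 (\<lambda>n. n mod 2)"
proof (rule recursive1_primrec[where g = "\<lambda>n v. 1 - v" and a = 0])
  show "recursive2 (\<lambda>n v. 1 - v :: nat)"
    by (rule recursive_minus(2)[OF recursive_const(2) recursive2_snd])
qed (simp_all, presburger)

lemma recursive1_div2: "recursive1 (\<lambda>n. n div 2)"
proof (rule recursive1_primrec[where g = "\<lambda>n v. v + n mod 2" and a = 0])
  show "recursive2 (\<lambda>n v. v + n mod 2 :: nat)"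
    by (rule recursive_plus(2)[OF recursive2_snd recursive_comp1(2)[OF recursive1_mod2 recursive2_fst]])
qed (simp_all, presburger)

text \<open>Finite tables are built from a constant function, one entry at a time.\<close>

lemma recursive1_fun_upd:
  assumes "recursive1 f"
  shows "recursive1 (f(a := v))"
proof -
  \<comment> \<open>\<open>1 - d\<close> is the truth value of \<open>x = a\<close>, for \<open>d\<close> the distance of \<open>x\<close> and \<open>a\<close>.\<close>
  have "recursive1 (\<lambda>x. (1 - ((x - a) + (a - x))) * v + (1 - (1 - ((x - a) + (a - x)))) * f x)"
    by (intro recursive_plus(1) recursive_times(1) recursive_minus(1) recursive_const recursive1_id assms)
  moreover have "(\<lambda>x. (1 - ((x - a) + (a - x))) * v + (1 - (1 - ((x - a) + (a - x)))) * f x) = f(a := v)"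
  proof (rule ext)
    fix x
    show "(1 - ((x - a) + (a - x))) * v + (1 - (1 - ((x - a) + (a - x)))) * f x = (f(a := v)) x"
      by (cases x a rule: linorder_cases) auto
  qed
  ultimately show ?thesis by simp
qed

lemma recursive1_bounded_support:
  fixes f :: "nat \<Rightarrow> nat"
  shows "recursive1 (\<lambda>n. if n < b then f n else 0)"
proof (induction b)
  case 0
  show ?case using recursive_const(1)[of 0] by simp
next
  case (Suc b)
  have "(\<lambda>n. if n < Suc b then f n else 0) = (\<lambda>n. if n < b then f n else 0)(b := f b)"
    by (auto simp: less_Suc_eq)
  then show ?case using recursive1_fun_upd[OF Suc] by simp
qed

text \<open>A special case of the Kleene normal form: the machine below iterates a total recursive step
  until a total recursive test succeeds, which takes one unbounded search.\<close>

lemma computable_search: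
  assumes "recursive2 e" and "recursive2 g"
  shows "\<exists>F. \<forall>x y. computes F [x] y \<longleftrightarrow>
    (\<exists>t. e t x = 0 \<and> (\<forall>t'<t. e t' x \<noteq> 0) \<and> y = g t x)"
proof -
  obtain re where re: "\<And>x y. computes re [x, y] (e x y)" using assms(1) unfolding recursive2_def by blast
  obtain rg where rg: "\<And>x y. computes rg [x, y] (g x y)" using assms(2) unfolding recursive2_def by blast
  have re': "computes re [x, y] v \<longleftrightarrow> v = e x y" for x y v
    using re computes_functional by blast
  have mu: "computes (Mu re) [x] t \<longleftrightarrow> e t x = 0 \<and> (\<forall>t'<t. e t' x \<noteq> 0)" for x t
  proof
    assume "computes (Mu re) [x] t"
    then show "e t x = 0 \<and> (\<forall>t'<t. e t' x \<noteq> 0)" by cases (auto simp: re')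
  next
    assume "e t x = 0 \<and> (\<forall>t'<t. e t' x \<noteq> 0)"
    then show "computes (Mu re) [x] t" by (intro computes.mu) (auto simp: re')
  qed
  have "computes (Comp rg [Mu re, Proj 0]) [x] y \<longleftrightarrow>
      (\<exists>t. e t x = 0 \<and> (\<forall>t'<t. e t' x \<noteq> 0) \<and> y = g t x)" for x y
  proof
    assume "computes (Comp rg [Mu re, Proj 0]) [x] y"
    then obtain t z where "computes (Mu re) [x] t" "computes (Proj 0) [x] z" "computes rg [t, z] y"
      by cases (auto simp: list_all2_Cons1)
    moreover have "z = x" using computes_functional computes_proj[of 0 "[x]" x] calculation(2) by simp
    moreover have "y = g t z" using computes_functional rg calculation(3) by blast
    ultimately show "\<exists>t. e t x = 0 \<and> (\<forall>t'<t. e t' x \<noteq> 0) \<and> y = g t x" using mu by blast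
  next
    assume "\<exists>t. e t x = 0 \<and> (\<forall>t'<t. e t' x \<noteq> 0) \<and> y = g t x"
    then obtain t where "computes (Mu re) [x] t" "y = g t x" using mu by blast
    then show "computes (Comp rg [Mu re, Proj 0]) [x] y"
      by (intro computes.comp[where zs = "[t, x]"]) (auto intro: rg computes_proj)
  qed
  then show ?thesis by blast
qed

section \<open>Recursive functions on coded strings\<close>

lemma string_code_append: "string_code (v @ w) = string_code v + 2 ^ length v * string_code w"
  by (induction v) (auto simp: algebra_simps)

lemma string_code_tl: "string_code (tl w) = (string_code w - 1) div 2"
  by (cases w) auto

lemma string_code_bound: "string_code w + 2 \<le> 2 ^ Suc (length w)"
  by (induction w) auto

lemma recursive1_funpow: "recursive1 h \<Longrightarrow> recursive1 (h ^^ n)"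
proof (induction n)
  case 0 then show ?case using recursive1_id by (simp add: id_def)
next
  case (Suc n) then show ?case using recursive_comp1(1)[of h "h ^^ n"] by (simp add: o_def)
qed

lemma recursive1_drop: "\<exists>h. recursive1 h \<and> (\<forall>w. h (string_code w) = string_code (drop n w))"
proof (intro exI conjI allI)
  show "recursive1 ((\<lambda>x. (x - 1) div 2) ^^ n)"
    by (intro recursive1_funpow recursive_comp1(1)[OF recursive1_div2] recursive1_pred)
  show "((\<lambda>x. (x - 1) div 2) ^^ n) (string_code w) = string_code (drop n w)" for w
  proof (induction n)
    case (Suc n)
    have "drop (Suc n) w = tl (drop n w)" by (simp add: drop_Suc tl_drop)
    then show ?case using Suc string_code_tl[of "drop n w"] by simp
  qed simp
qed

text \<open>The first \<open>n\<close> bits of a string range over a finite set, so an arbitrary function of them,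
  such as a table of codewords, is recursive. Their code is the difference between the code of
  the whole string and \<open>2 ^ n\<close> times the code of the remainder.\<close>

lemma recursive1_prefix_table:
  "\<exists>h. recursive1 h \<and> (\<forall>w. h (string_code w) = string_code (f (take n w)))"
proof -
  obtain d where d: "recursive1 d" "\<And>w. d (string_code w) = string_code (drop n w)"
    using recursive1_drop by blast
  define tab where "tab x = (if x < 2 ^ Suc n then string_code (f (the_inv string_code x)) else 0)" for x
  have tab: "recursive1 tab" unfolding tab_def by (rule recursive1_bounded_support)
  define h where "h x = tab (x - 2 ^ n * d x)" for x
  have "recursive1 h"
    unfolding h_def
    by (intro recursive_comp1(1)[OF tab] recursive_minus recursive_times recursive1_id recursive_const d(1))
  moreover have "h (string_code w) = string_code (f (take n w))" for w
  proof -
    have "string_code w = string_code (take n w) + 2 ^ length (take n w) * string_code (drop n w)"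
      by (metis append_take_drop_id string_code_append)
    also have "2 ^ length (take n w) * string_code (drop n w) = 2 ^ n * string_code (drop n w)"
      by (cases "n \<le> length w") auto
    finally have "string_code w - 2 ^ n * d (string_code w) = string_code (take n w)"
      using d(2)[of w] by simp
    moreover have "string_code (take n w) < 2 ^ Suc n"
    proof -
      have "string_code (take n w) < 2 ^ Suc (length (take n w))"
        using string_code_bound[of "take n w"] by simp
      also have "\<dots> \<le> 2 ^ Suc n" by (intro power_increasing) auto
      finally show ?thesis .
    qed
    moreover have "the_inv string_code (string_code u) = u" for u
      by (intro the_inv_f_f bij_is_inj bij_string_code)
    ultimately show ?thesis by (simp add: h_def tab_def)
  qed
  ultimately show ?thesis by blast
qed

section \<open>A machine that decodes blocks\<close>

text \<open>An input of the machine has the form \<open>1 b\<^sub>1 1 b\<^sub>2 \<dots> 1 b\<^sub>t 0\<close> with blocks of length \<open>l\<close>. A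
  step removes one marked block. The stop bit \<open>0\<close> leads to the empty string, on which the
  iteration stays, so the string \<open>[False]\<close> is met at most once.\<close>

fun strip :: "nat \<Rightarrow> bool list \<Rightarrow> bool list" where
  "strip l (True # p) = drop l p"
| "strip l p = []"

text \<open>Later blocks of the input are put in front of the output. Prepending a word of length \<open>m\<close> to
  \<open>w\<close> acts on codes as \<open>x \<mapsto> c + 2 ^ m * x\<close> with \<open>x\<close> the code of \<open>w\<close>, so the accumulated output
  is a primitive recursion that does not have to track its length.\<close>

primrec decoded :: "nat \<Rightarrow> (bool list \<Rightarrow> bool list) \<Rightarrow> nat \<Rightarrow> bool list \<Rightarrow> bool list" where
  "decoded l D 0 p = []"
| "decoded l D (Suc t) p = D (take l (tl ((strip l ^^ t) p))) @ decoded l D t p"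

definition block_machine ::
  "bool list \<Rightarrow> nat \<Rightarrow> (bool list \<Rightarrow> bool list) \<Rightarrow> bool list \<Rightarrow> bool list option" where
  "block_machine \<sigma> l D p =
     (if \<exists>t. (strip l ^^ t) p = [False]
      then Some (\<sigma> @ decoded l D (LEAST t. (strip l ^^ t) p = [False]) p) else None)"

lemma strip_funpow_Nil: "(strip l ^^ t) [] = []"
  by (induction t) auto

lemma strip_funpow_after_stop:
  assumes "(strip l ^^ t) p = False # z" and "t < t'"
  shows "(strip l ^^ t') p = []"
proof -
  have "t' = (t' - Suc t) + Suc t" using assms(2) by simp
  then have "(strip l ^^ t') p = (strip l ^^ (t' - Suc t)) ((strip l ^^ Suc t) p)"
    by (metis comp_apply funpow_add)
  then show ?thesis using assms(1) by (simp add: strip_funpow_Nil)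
qed

text \<open>Until the stop bit is reached, the machine reads only bits that are present, and so it does
  not notice a continuation of its input. This makes the domain of the machine prefix-free.\<close>

lemma strip_funpow_append:
  "(strip l ^^ t) p = [False] \<Longrightarrow> (strip l ^^ t) (p @ z) = False # z"
proof (induction t arbitrary: p)
  case 0
  then show ?case by simp
next
  case (Suc t)
  have *: "(strip l ^^ t) (strip l p) = [False]" using Suc.prems by (simp add: funpow_swap1)
  then have "strip l p \<noteq> []" by (auto simp: strip_funpow_Nil)
  then obtain w where w: "p = True # w" "drop l w \<noteq> []"
    by (metis (full_types) neq_Nil_conv strip.simps)
  then have "strip l (p @ z) = strip l p @ z" by simp
  then show ?case using Suc.IH[OF *] by (simp add: funpow_swap1)
qed

lemma block_machine_eq:
  assumes "(strip l ^^ t) p = [False]"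
  shows "block_machine \<sigma> l D p = Some (\<sigma> @ decoded l D t p)"
proof -
  have "(LEAST t. (strip l ^^ t) p = [False]) = t"
  proof (rule Least_equality[where P = "\<lambda>t. (strip l ^^ t) p = [False]", OF assms])
    fix t' assume "(strip l ^^ t') p = [False]"
    then show "t \<le> t'" using assms strip_funpow_after_stop[of t' l p "[]" t] by (cases "t' < t") auto
  qed
  then show ?thesis using assms unfolding block_machine_def by auto
qed

text \<open>All data of the decoder are finite, so its steps act on codes by elementary recursive
  functions; the number of steps is found by searching for the remainder \<open>[False]\<close>, whose code
  is \<open>1\<close>.\<close>

lemma partial_computable_block_machine:
  fixes D :: "bool list \<Rightarrow> bool list"
  assumes "\<And>b. length (D b) = m"
  shows "partial_computable (block_machine \<sigma> l D)"
proof -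
  obtain d where d: "recursive1 d" "\<And>w. d (string_code w) = string_code (drop (Suc l) w)"
    using recursive1_drop by blast
  obtain h where h: "recursive1 h"
    "\<And>w. h (string_code w) = string_code (D (tl (take (Suc l) w)))"
    using recursive1_prefix_table[where f = "\<lambda>u. D (tl u)" and n = "Suc l"] by blast
  \<comment> \<open>A string is empty or starts with \<open>True\<close> iff its code is even.\<close>
  have strip: "string_code (strip l p) = (1 - string_code p mod 2) * d (string_code p)" for p
  proof (cases p)
    case (Cons b w)
    have *: "string_code p mod 2 = (if b then 0 else 1)" unfolding Cons by (cases b) simp_all
    have "strip l p = (if b then drop (Suc l) p else [])" unfolding Cons by (cases b) simp_all
    then show ?thesis unfolding * d(2) by (cases b) simp_all
  qed (use d(2)[of "[]"] in simp)
  define rest where "rest = rec_nat (\<lambda>x. x) (\<lambda>n v x. (1 - v x mod 2) * d (v x))"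
  have rest_simps: "rest 0 x = x" "rest (Suc n) x = (1 - rest n x mod 2) * d (rest n x)" for n x
    by (simp_all add: rest_def)
  have "recursive3 (\<lambda>n v x. (1 - v mod 2) * d v)"
    by (intro recursive_times recursive_minus recursive_const recursive3_proj
        recursive_comp1(3)[OF d(1)] recursive_comp1(3)[OF recursive1_mod2])
  then have rest: "recursive2 rest"
    by (rule recursive2_primrec[OF recursive1_id]) (simp_all add: rest_simps)
  have rest_code: "rest t (string_code p) = string_code ((strip l ^^ t) p)" for t p
    by (induction t) (simp_all add: rest_simps strip)
  define out where "out = rec_nat (\<lambda>x. 0) (\<lambda>n v x. h (rest n x) + 2 ^ m * v x)"
  have out_simps: "out 0 x = 0" "out (Suc n) x = h (rest n x) + 2 ^ m * out n x" for n x
    by (simp_all add: out_def)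
  have "recursive3 (\<lambda>n v x. h (rest n x) + 2 ^ m * v)"
    by (intro recursive_plus recursive_times recursive_const recursive3_proj
        recursive_comp1(3)[OF h(1)] recursive_comp2(3)[OF rest])
  then have out: "recursive2 out"
    by (rule recursive2_primrec[OF recursive_const(1)[of 0]]) (simp_all add: out_simps)
  have tl_take: "tl (take (Suc l) w) = take l (tl w)" for w :: "bool list"
    by (cases w) auto
  have out_code: "out t (string_code p) = string_code (decoded l D t p)" for t p
    by (induction t) (simp_all add: out_simps rest_code h(2) string_code_append assms tl_take)
  define e where "e t x = (rest t x - 1) + (1 - rest t x)" for t x
  have "recursive2 e"
    unfolding e_def by (intro recursive_plus recursive_minus recursive_const rest)
  moreover define g where "g t x = string_code \<sigma> + 2 ^ length \<sigma> * out t x" for t x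
  have "recursive2 g"
    unfolding g_def by (intro recursive_plus recursive_times recursive_const out)
  ultimately obtain F where F: "\<And>x y. computes F [x] y \<longleftrightarrow>
      (\<exists>t. e t x = 0 \<and> (\<forall>t'<t. e t' x \<noteq> 0) \<and> y = g t x)"
    using computable_search by blast
  have inj: "string_code u = string_code v \<longleftrightarrow> u = v" for u v
    using bij_string_code by (metis bij_is_inj injD)
  have e_code: "e t (string_code p) = 0 \<longleftrightarrow> (strip l ^^ t) p = [False]" for t p
  proof -
    have "e t (string_code p) = 0 \<longleftrightarrow> string_code ((strip l ^^ t) p) = string_code [False]"
      unfolding e_def rest_code by auto
    then show ?thesis by (simp only: inj)
  qed
  have g_code: "g t (string_code p) = string_code (\<sigma> @ decoded l D t p)" for t p
    by (simp add: g_def out_code string_code_append)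
  have "block_machine \<sigma> l D p = Some w \<longleftrightarrow> computes F [string_code p] (string_code w)" for p w
  proof
    assume M: "block_machine \<sigma> l D p = Some w"
    then have ex: "\<exists>t. (strip l ^^ t) p = [False]"
      by (auto simp: block_machine_def split: if_splits)
    define t where "t = (LEAST t. (strip l ^^ t) p = [False])"
    have "(strip l ^^ t) p = [False]" "\<forall>t'<t. (strip l ^^ t') p \<noteq> [False]"
      using LeastI_ex[OF ex] not_less_Least unfolding t_def by blast+
    moreover have "w = \<sigma> @ decoded l D t p" using M ex by (simp add: block_machine_def t_def)
    ultimately show "computes F [string_code p] (string_code w)"
      unfolding F e_code g_code inj by blast
  next
    assume "computes F [string_code p] (string_code w)"
    then show "block_machine \<sigma> l D p = Some w"
      unfolding F e_code g_code inj using block_machine_eq by blast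
  qed
  then show ?thesis unfolding partial_computable_def by blast
qed

lemma prefix_free_block_machine:
  fixes D :: "bool list \<Rightarrow> bool list"
  assumes "\<And>b. length (D b) = m"
  shows "prefix_free_machine (block_machine \<sigma> l D)"
  unfolding prefix_free_machine_def
proof (intro conjI ballI impI)
  show "partial_computable (block_machine \<sigma> l D)"
    using assms by (rule partial_computable_block_machine)
next
  fix p q assume "p \<in> dom (block_machine \<sigma> l D)" "q \<in> dom (block_machine \<sigma> l D)" "prefix p q"
  then obtain t t' z where t: "(strip l ^^ t) p = [False]" and t': "(strip l ^^ t') q = [False]"
    and q: "q = p @ z"
    by (auto simp: block_machine_def prefix_def split: if_splits)
  have stop: "(strip l ^^ t) q = False # z" unfolding q using t by (rule strip_funpow_append)
  then have "t = t'"
    using t' strip_funpow_after_stop[OF stop, of t'] strip_funpow_after_stop[OF t', of t]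
    by (metis linorder_cases list.distinct(1))
  with stop t' q show "p = q" by simp
qed

definition frame :: "bool list list \<Rightarrow> bool list" where
  "frame bs = concat (map ((#) True) bs) @ [False]"

lemma length_frame: "\<forall>b\<in>set bs. length b = l \<Longrightarrow> length (frame bs) = length bs * (l + 1) + 1"
  by (induction bs) (auto simp: frame_def)

lemma strip_frame:
  assumes "\<forall>b\<in>set bs. length b = l" and "i \<le> length bs"
  shows "(strip l ^^ i) (frame bs) = frame (drop i bs)"
  using assms(2)
proof (induction i)
  case (Suc i)
  then have "frame (drop i bs) = True # (bs ! i) @ frame (drop (Suc i) bs)"
    by (subst Cons_nth_drop_Suc[symmetric]) (auto simp: frame_def)
  with Suc assms(1) show ?case by simp
qed simp

lemma decoded_frame:
  assumes "\<forall>b\<in>set bs. length b = l" and "i \<le> length bs"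
  shows "decoded l D i (frame bs) = concat (map D (rev (take i bs)))"
  using assms(2)
proof (induction i)
  case (Suc i)
  then have "frame (drop i bs) = True # (bs ! i) @ frame (drop (Suc i) bs)"
    by (subst Cons_nth_drop_Suc[symmetric]) (auto simp: frame_def)
  with Suc assms strip_frame[of bs l i] show ?case by (simp add: take_Suc_conv_app_nth)
qed simp

text \<open>The overhead of naming \<open>t\<close> blocks is one continuation bit per block and a constant \<open>c\<close>,
  which may depend on \<open>\<sigma>\<close> and on the code but not on \<open>t\<close>. The blocks are fed in reverse
  because the machine prepends.\<close>

lemma complexity_block_code:
  fixes D :: "bool list \<Rightarrow> bool list"
  assumes U: "optimal_prefix_free_machine U" and D: "\<And>b. length (D b) = m"
  shows "\<exists>c. \<forall>bs. (\<forall>b\<in>set bs. length b = l) \<longrightarrow>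
    complexity U (\<sigma> @ concat (map D bs)) \<le> enat (length bs * (l + 1) + c)"
proof -
  obtain c where c: "\<And>w. complexity U w \<le> complexity (block_machine \<sigma> l D) w + enat c"
    using U prefix_free_block_machine[of D m \<sigma> l] D
    unfolding optimal_prefix_free_machine_def by blast
  have "complexity U (\<sigma> @ concat (map D bs)) \<le> enat (length bs * (l + 1) + (1 + c))"
    if bs: "\<forall>b\<in>set bs. length b = l" for bs
  proof -
    let ?p = "frame (rev bs)"
    have l: "\<forall>b\<in>set (rev bs). length b = l" using bs by simp
    have "(strip l ^^ length bs) ?p = [False]"
      using strip_frame[OF l, of "length bs"] by (simp add: frame_def)
    then have "block_machine \<sigma> l D ?p = Some (\<sigma> @ concat (map D bs))"
      using decoded_frame[OF l, of "length bs" D] by (simp add: block_machine_eq)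
    then have "complexity (block_machine \<sigma> l D) (\<sigma> @ concat (map D bs)) \<le> enat (length ?p)"
      unfolding complexity_def by (intro INF_lower) simp
    then have "complexity (block_machine \<sigma> l D) (\<sigma> @ concat (map D bs)) + enat c
        \<le> enat (length ?p) + enat c" by (rule add_right_mono)
    with c[of "\<sigma> @ concat (map D bs)"] show ?thesis
      using order_trans by (force simp: length_frame[OF l] add.assoc)
  qed
  then show ?thesis by blast
qed

section \<open>The binary entropy function\<close>

text \<open>At \<open>0\<close> the factor \<open>p\<close> makes the defining formula vanish, and continuity there amounts to
  \<open>p * log 2 p\<close> tending to \<open>0\<close>.\<close>

lemma continuous_on_binary_entropy: "continuous_on {0..1/2} binary_entropy"
proof -
  have "(binary_entropy \<longlongrightarrow> binary_entropy x) (at x within {0..1/2})" if "x \<in> {0..1/2}" for x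
  proof (cases "x = 0")
    case True
    have "((\<lambda>p::real. - (p * log 2 p + (1 - p) * log 2 (1 - p))) \<longlongrightarrow> 0) (at_right 0)"
      by real_asymp
    then have "(binary_entropy \<longlongrightarrow> 0) (at_right 0)"
      by (simp add: binary_entropy_def[abs_def])
    moreover have "at 0 within {0..1/2} = at_right (0::real)"
      by (simp add: at_within_Icc_at_right)
    ultimately show ?thesis by (simp add: True binary_entropy_0)
  next
    case False
    with that have "0 < x" "x < 1" by auto
    then show ?thesis
      unfolding binary_entropy_def[abs_def] by (intro tendsto_intros) auto
  qed
  then show ?thesis by (simp add: continuous_on_def)
qed

lemma strict_mono_on_binary_entropy: "strict_mono_on {0..1/2} binary_entropy"
proof (rule strict_mono_onI)
  fix x y :: real assume xy: "x \<in> {0..1/2}" "y \<in> {0..1/2}" "x < y"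
  show "binary_entropy x < binary_entropy y"
  proof (rule DERIV_pos_imp_increasing_open[OF xy(3)])
    fix z assume z: "x < z" "z < y"
    then have "0 < z" "z < 1/2" using xy by auto
    then have "((\<lambda>p. - (p * ln p + (1 - p) * ln (1 - p)) / ln 2) has_real_derivative
        (ln (1 - z) - ln z) / ln 2) (at z)"
      by (auto intro!: derivative_eq_intros)
    moreover have "binary_entropy = (\<lambda>p. - (p * ln p + (1 - p) * ln (1 - p)) / ln 2)"
      by (simp add: fun_eq_iff binary_entropy_def log_def field_simps)
    moreover have "(ln (1 - z) - ln z) / ln 2 > 0" using \<open>0 < z\<close> \<open>z < 1/2\<close> by simp
    ultimately show "\<exists>d. (binary_entropy has_real_derivative d) (at z) \<and> d > 0" by metis
  next
    show "continuous_on {x..y} binary_entropy"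
      by (rule continuous_on_subset[OF continuous_on_binary_entropy]) (use xy in auto)
  qed
qed

lemma inv_binary_entropy:
  assumes "t \<in> {0..1}"
  shows "inv_binary_entropy t \<in> {0..1/2}" and "binary_entropy (inv_binary_entropy t) = t"
proof -
  have inj: "inj_on binary_entropy {0..1/2}"
    by (rule strict_mono_on_imp_inj_on[OF strict_mono_on_binary_entropy])
  have half: "binary_entropy (1/2) = 1"
    by (simp add: binary_entropy_def log_divide)
  have "\<exists>x\<ge>0. x \<le> 1/2 \<and> binary_entropy x = t"
    by (rule IVT') (use assms half continuous_on_binary_entropy in \<open>auto simp: binary_entropy_0\<close>)
  then have im: "t \<in> binary_entropy ` {0..1/2}" by auto
  show "inv_binary_entropy t \<in> {0..1/2}"
    unfolding inv_binary_entropy_def by (rule the_inv_into_into[OF inj im order_refl])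
  show "binary_entropy (inv_binary_entropy t) = t"
    unfolding inv_binary_entropy_def by (rule f_the_inv_into_f[OF inj im])
qed

section \<open>Binomial coefficients and entropy\<close>

text \<open>The binomial distribution has its mode at its mean \<open>p * m\<close> when that is an integer:
  consecutive terms have the ratio \<open>(m - i) * p / ((i + 1) * (1 - p))\<close>, which is at least \<open>1\<close>
  for \<open>i < k\<close> and at most \<open>1\<close> for \<open>i \<ge> k\<close>.\<close>

lemma binomial_term_le_mode:
  fixes p :: real and m k j :: nat
  assumes p: "0 \<le> p" "p < 1" and k: "k = p * m" and j: "j \<le> m"
  defines "a \<equiv> \<lambda>j. real (m choose j) * p ^ j * (1 - p) ^ (m - j)"
  shows "a j \<le> a k"
proof -
  have nonneg: "a j \<ge> 0" for j using p by (simp add: a_def)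
  have "real k \<le> real m" unfolding k using p by (simp add: mult_left_le_one_le)
  then have km: "k \<le> m" by simp
  have ratio: "a (Suc i) * (real (Suc i) * (1 - p)) = a i * (real (m - i) * p)" if "i < m" for i
  proof -
    have absorb: "real (m choose Suc i) * real (Suc i) = real (m choose i) * real (m - i)"
      using binomial_absorb_comp[of m i] binomial_absorption[of i m]
      by (metis mult.commute of_nat_mult Suc_diff_Suc)
    have "a (Suc i) * (real (Suc i) * (1 - p)) =
        (real (m choose Suc i) * real (Suc i)) * p ^ Suc i * ((1 - p) ^ (m - Suc i) * (1 - p))"
      by (simp only: a_def mult_ac)
    also note absorb
    also have "(1 - p) ^ (m - Suc i) * (1 - p) = (1 - p) ^ (m - i)"
      using that by (metis Suc_diff_Suc power_Suc2)
    finally show ?thesis by (simp add: a_def mult_ac)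
  qed
  have up: "a i \<le> a (Suc i)" if "i < k" for i
  proof -
    have i: "i < m" using that km by simp
    have "real (Suc i) \<le> real m * p" using that k by (metis Suc_leI mult.commute of_nat_mono)
    then have "real (Suc i) * (1 - p) \<le> real (m - i) * p"
      using i p by (simp add: algebra_simps of_nat_diff)
    then have "a i * (real (Suc i) * (1 - p)) \<le> a (Suc i) * (real (Suc i) * (1 - p))"
      unfolding ratio[OF i] using nonneg by (rule mult_left_mono)
    then show ?thesis using p by (simp add: mult_le_cancel_right)
  qed
  have down: "a (Suc i) \<le> a i" if "k \<le> i" "i < m" for i
  proof -
    have "real m * p \<le> real i" using that k by (metis mult.commute of_nat_mono)
    then have "real (m - i) * p \<le> real (Suc i) * (1 - p)"
      using that p by (simp add: algebra_simps of_nat_diff)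
    then have "a (Suc i) * (real (Suc i) * (1 - p)) \<le> a i * (real (Suc i) * (1 - p))"
      unfolding ratio[OF that(2)] using nonneg by (rule mult_left_mono)
    then show ?thesis using p by (simp add: mult_le_cancel_right)
  qed
  show ?thesis
  proof (cases "j \<le> k")
    case True
    then show ?thesis
    proof (induction rule: inc_induct)
      case (step n)
      then show ?case using up[of n] by linarith
    qed simp
  next
    case False
    then have "k \<le> j" by simp
    then show ?thesis using j
    proof (induction rule: dec_induct)
      case (step n)
      then show ?case using down[of n] by simp
    qed simp
  qed
qed

text \<open>With \<open>p = k / m\<close> the \<open>m + 1\<close> terms of \<open>(p + (1 - p)) ^ m = 1\<close> are largest at \<open>k\<close>, so that
  term is at least \<open>1 / (m + 1)\<close>. Its weight \<open>p ^ k * (1 - p) ^ (m - k)\<close> is \<open>2\<close> to the power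
  \<open>- m * binary_entropy p\<close>.\<close>

lemma binomial_entropy_lower_bound:
  assumes m: "0 < m" and k: "2 * k \<le> m"
  shows "2 powr (m * binary_entropy (k / m)) \<le> real (m + 1) * real (m choose k)"
proof -
  define p where "p = real k / real m"
  have p: "0 \<le> p" "p \<le> 1/2" and kp: "k = p * m" using m k by (auto simp: p_def field_simps)
  have km: "k \<le> m" using k by simp
  have "1 = (p + (1 - p)) ^ m" by simp
  also have "\<dots> = (\<Sum>j\<le>m. real (m choose j) * p ^ j * (1 - p) ^ (m - j))" by (rule binomial_ring)
  also have "\<dots> \<le> (\<Sum>j\<le>m. real (m choose k) * p ^ k * (1 - p) ^ (m - k))"
    using p kp by (intro sum_mono binomial_term_le_mode) auto
  finally have 1: "1 \<le> real (m + 1) * real (m choose k) * (p ^ k * (1 - p) ^ (m - k))"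
    by (simp add: algebra_simps)
  have pk: "p ^ k = 2 powr (m * (p * log 2 p))"
  proof (cases "k = 0")
    case True then show ?thesis by (simp add: p_def)
  next
    case False
    then have "0 < p" using m by (simp add: p_def)
    have "p ^ k = (2 powr log 2 p) powr real k" using \<open>0 < p\<close> by (simp add: powr_realpow)
    also have "\<dots> = 2 powr (log 2 p * real k)" by (rule powr_powr)
    also have "log 2 p * real k = m * (p * log 2 p)" by (simp add: kp)
    finally show ?thesis .
  qed
  have mk: "real (m - k) = m * (1 - p)" using km kp by (simp add: of_nat_diff algebra_simps)
  have qk: "(1 - p) ^ (m - k) = 2 powr (m * ((1 - p) * log 2 (1 - p)))"
  proof -
    have "(1 - p) ^ (m - k) = (2 powr log 2 (1 - p)) powr real (m - k)"
      using p by (simp add: powr_realpow del: of_nat_diff)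
    also have "\<dots> = 2 powr (log 2 (1 - p) * real (m - k))" by (rule powr_powr)
    also have "log 2 (1 - p) * real (m - k) = m * ((1 - p) * log 2 (1 - p))"
      by (simp only: mk mult_ac)
    finally show ?thesis .
  qed
  have "p ^ k * (1 - p) ^ (m - k) = 2 powr (- (m * binary_entropy p))"
    unfolding pk qk powr_add[symmetric] binary_entropy_def by (simp add: algebra_simps)
  with 1 have "1 \<le> real (m + 1) * real (m choose k) / 2 powr (m * binary_entropy p)"
    by (simp add: powr_minus divide_inverse)
  then show ?thesis unfolding p_def by (simp add: le_divide_eq)
qed

section \<open>Covering codes\<close>

text \<open>If every point has \<open>V\<close> neighbours, then a centre chosen at random covers on average the
  fraction \<open>V / card X\<close> of the points that are still uncovered. Some centre does at least as
  well as the average, so each greedy choice multiplies the number of uncovered points by at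
  most \<open>1 - V / card X\<close>.\<close>

lemma greedy_covering:
  fixes X :: "'a set" and R :: "'a \<Rightarrow> 'a \<Rightarrow> bool" and V :: nat
  assumes X: "finite X" "X \<noteq> {}" and deg: "\<And>y. y \<in> X \<Longrightarrow> card {x \<in> X. R x y} = V"
  shows "\<exists>C\<subseteq>X. card C \<le> N \<and>
    real (card {y \<in> X. \<forall>x\<in>C. \<not> R x y}) \<le> card X * (1 - V / card X) ^ N"
proof (induction N)
  case 0
  show ?case by (intro exI[of _ "{}"]) simp
next
  case (Suc N)
  then obtain C where C: "C \<subseteq> X" "card C \<le> N"
    "real (card {y \<in> X. \<forall>x\<in>C. \<not> R x y}) \<le> card X * (1 - V / card X) ^ N" by blast
  define U where "U = {y \<in> X. \<forall>x\<in>C. \<not> R x y}"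
  have U: "finite U" "U \<subseteq> X" using X by (auto simp: U_def)
  have cX: "0 < card X" using X by (simp add: card_gt_0_iff)
  have sum: "(\<Sum>x\<in>X. card {y \<in> U. R x y}) = V * card U"
    using X U deg by (intro sum_multicount) auto
  have "\<exists>x\<in>X. real V * card U \<le> card X * real (card {y \<in> U. R x y})"
  proof (rule ccontr)
    assume "\<not> ?thesis"
    then have "card X * real (card {y \<in> U. R x y}) < real V * card U" if "x \<in> X" for x
      using that by (simp add: not_le)
    then have "(\<Sum>x\<in>X. card X * real (card {y \<in> U. R x y})) < (\<Sum>x\<in>X. real V * card U)"
      using X by (intro sum_strict_mono)
    also have "\<dots> = card X * real (\<Sum>x\<in>X. card {y \<in> U. R x y})" by (simp add: sum)
    finally show False by (simp add: sum_distrib_left)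
  qed
  then obtain x where x: "x \<in> X" "real V * card U \<le> card X * real (card {y \<in> U. R x y})"
    by blast
  have "V \<le> card X"
    using X deg card_mono[OF X(1), of "{x' \<in> X. R x' x}"] x(1) by auto
  then have q: "0 \<le> 1 - V / card X" using cX by simp
  have "{y \<in> X. \<forall>x'\<in>insert x C. \<not> R x' y} = U - {y \<in> U. R x y}" by (auto simp: U_def)
  then have "real (card {y \<in> X. \<forall>x'\<in>insert x C. \<not> R x' y}) = card U - real (card {y \<in> U. R x y})"
    using U card_mono[of U "{y \<in> U. R x y}"] by (simp add: card_Diff_subset of_nat_diff)
  also have "\<dots> \<le> card U - real V * card U / card X"
    using x(2) cX by (simp add: field_simps)
  also have "\<dots> = (1 - V / card X) * card U" by (simp add: algebra_simps)
  also have "\<dots> \<le> (1 - V / card X) * (card X * (1 - V / card X) ^ N)"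
    using C(3) q unfolding U_def by (rule mult_left_mono)
  finally have "real (card {y \<in> X. \<forall>x'\<in>insert x C. \<not> R x' y}) \<le> card X * (1 - V / card X) ^ Suc N"
    by (simp add: mult_ac)
  moreover have "card (insert x C) \<le> Suc N"
    using C(2) finite_subset[OF C(1) X(1)] by (simp add: card_insert_if)
  ultimately show ?case using C(1) x(1) by (intro exI[of _ "insert x C"]) auto
qed

definition errors :: "bool list \<Rightarrow> bool list \<Rightarrow> nat set" where
  "errors v w = {i. i < length v \<and> v ! i \<noteq> w ! i}"

lemma card_sphere:
  assumes "length w = m"
  shows "card {v. length v = m \<and> card (errors v w) = k} = m choose k"
proof -
  define flip where "flip K = map (\<lambda>i. (w ! i) \<noteq> (i \<in> K)) [0..<m]" for K
  have errors_flip: "errors (flip K) w = K" if "K \<subseteq> {..<m}" for K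
    using that by (auto simp: errors_def flip_def)
  have "bij_betw flip {K. K \<subseteq> {..<m} \<and> card K = k} {v. length v = m \<and> card (errors v w) = k}"
  proof (rule bij_betw_byWitness[where f' = "\<lambda>v. errors v w"])
    show "\<forall>v\<in>{v. length v = m \<and> card (errors v w) = k}. flip (errors v w) = v"
      by (auto simp: flip_def errors_def intro!: nth_equalityI)
    show "flip ` {K. K \<subseteq> {..<m} \<and> card K = k} \<subseteq> {v. length v = m \<and> card (errors v w) = k}"
      using errors_flip by (auto simp: flip_def)
    show "(\<lambda>v. errors v w) ` {v. length v = m \<and> card (errors v w) = k} \<subseteq> {K. K \<subseteq> {..<m} \<and> card K = k}"
      by (auto simp: errors_def)
  qed (simp add: errors_flip)
  then have "card {v. length v = m \<and> card (errors v w) = k} = card {K. K \<subseteq> {..<m} \<and> card K = k}"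
    by (rule bij_betw_same_card[symmetric])
  then show ?thesis by (simp add: n_subsets)
qed

lemma card_bitstrings: "card {b :: bool list. length b = l} = 2 ^ l"
  using card_lists_length_eq[of "UNIV :: bool set" l] by simp

lemma finite_bitstrings: "finite {b :: bool list. length b = l}"
  using finite_lists_length_eq[of "UNIV :: bool set" l] by simp

text \<open>Let \<open>V = m choose k\<close>. The greedy choice of \<open>2 ^ l\<close> centres leaves at most
  \<open>2 ^ m * (1 - V / 2 ^ m) ^ (2 ^ l)\<close> words uncovered. By the bound on \<open>l\<close> this is at most
  \<open>2 ^ m * exp (- m)\<close>, which is below \<open>1\<close>, so no word is left.\<close>

lemma covering_code:
  assumes m: "0 < m" and l: "real m * 2 ^ m \<le> real (m choose k) * 2 ^ l"
  shows "\<exists>D :: bool list \<Rightarrow> bool list. (\<forall>b. length (D b) = m) \<and>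
    (\<forall>w. length w = m \<longrightarrow> (\<exists>b. length b = l \<and> card (errors (D b) w) = k))"
proof -
  define X where "X = {v :: bool list. length v = m}"
  have X: "finite X" "X \<noteq> {}" and cX: "card X = 2 ^ m"
    using finite_bitstrings card_bitstrings Ex_list_of_length by (auto simp: X_def)
  define V where "V = m choose k"
  have deg: "card {v \<in> X. card (errors v w) = k} = V" if "w \<in> X" for w
    using that card_sphere by (simp add: X_def V_def)
  obtain C where C: "C \<subseteq> X" "card C \<le> 2 ^ l"
    "real (card {w \<in> X. \<forall>v\<in>C. card (errors v w) \<noteq> k}) \<le> card X * (1 - V / card X) ^ (2 ^ l)"
    using greedy_covering[of X "\<lambda>v w. card (errors v w) = k" V "2 ^ l", OF X deg] by blast
  have "V \<le> card X"
    using X deg card_mono[of X] by (metis (no_types, lifting) ex_in_conv mem_Collect_eq subsetI)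
  then have V: "V / 2 ^ m \<le> 1" by (simp add: cX)
  have "real (card {w \<in> X. \<forall>v\<in>C. card (errors v w) \<noteq> k}) \<le> 2 ^ m * (1 - V / 2 ^ m) ^ (2 ^ l)"
    using C(3) by (simp add: cX)
  also have "(1 - V / 2 ^ m) ^ (2 ^ l) \<le> exp (- (V / 2 ^ m)) ^ (2 ^ l)"
    using V exp_ge_add_one_self[of "- (V / 2 ^ m)"] by (intro power_mono) auto
  also have "\<dots> = exp (- (real V * 2 ^ l / 2 ^ m))"
    by (simp add: exp_of_nat_mult[symmetric] mult_ac)
  also have "\<dots> \<le> exp (- real m)" using l by (simp add: V_def field_simps)
  finally have "real (card {w \<in> X. \<forall>v\<in>C. card (errors v w) \<noteq> k}) \<le> 2 ^ m * exp (- real m)"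
    by simp
  also have "\<dots> = (2 * exp (- 1)) ^ m"
    using exp_of_nat_mult[of m "-1 :: real"] by (simp add: power_mult_distrib)
  also have "\<dots> < 1"
  proof -
    have "(2::real) < exp 1" using exp_lower_Taylor_quadratic[of 1] by simp
    then have "2 * exp (- 1 :: real) < 1" by (simp add: exp_minus field_simps)
    then show ?thesis using m by (subst power_less_one_iff) auto
  qed
  finally have "card {w \<in> X. \<forall>v\<in>C. card (errors v w) \<noteq> k} = 0" by simp
  then have cov: "\<exists>v\<in>C. card (errors v w) = k" if "w \<in> X" for w
    using that X(1) by auto
  have "finite C" using C(1) X(1) by (rule finite_subset)
  moreover have "card C \<le> card {b :: bool list. length b = l}" using C(2) by (simp add: card_bitstrings)
  ultimately obtain f where f: "f ` C \<subseteq> {b :: bool list. length b = l}" "inj_on f C"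
    using card_le_inj[OF _ finite_bitstrings] by blast
  have "C \<noteq> {}" using cov X(2) by auto
  \<comment> \<open>Names outside the range of \<open>f\<close> also have to decode to words of length \<open>m\<close>.\<close>
  define D where "D b = (if b \<in> f ` C then the_inv_into C f b else (SOME v. v \<in> C))" for b
  have "D b \<in> C" for b
    using \<open>C \<noteq> {}\<close> f(2) by (auto simp: D_def some_in_eq the_inv_into_f_f)
  then have "length (D b) = m" for b using C(1) by (auto simp: X_def)
  moreover have "\<exists>b. length b = l \<and> card (errors (D b) w) = k" if "length w = m" for w
  proof -
    obtain v where v: "v \<in> C" "card (errors v w) = k" using cov \<open>length w = m\<close> by (auto simp: X_def)
    then have "D (f v) = v" by (simp add: D_def the_inv_into_f_f[OF f(2)])
    then show ?thesis using v f(1) by (intro exI[of _ "f v"]) auto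
  qed
  ultimately show ?thesis by blast
qed

text \<open>Take the radius \<open>k = \<lfloor>r * m\<rfloor>\<close>. Then \<open>k / m\<close> tends to \<open>r\<close>, so by continuity of the entropy
  the number \<open>l / m\<close> of bits per symbol that the covering needs gets below \<open>s + \<epsilon>\<close>: the factor
  \<open>m\<close> from the greedy choice and the factor \<open>m + 1\<close> from the entropy bound add only a
  logarithmic number of bits. The additional bit in \<open>l + 1\<close> marks the block for the machine.\<close>

lemma good_covering_code:
  assumes s: "s \<in> {0..1}" and r: "r = inv_binary_entropy (1 - s)" and \<epsilon>: "0 < \<epsilon>"
  shows "\<exists>m l (D :: bool list \<Rightarrow> bool list).
    0 < m \<and> real (l + 1) \<le> (s + \<epsilon>) * m \<and> (\<forall>b. length (D b) = m) \<and>
    (\<forall>w. length w = m \<longrightarrow> (\<exists>b. length b = l \<and> real (card (errors (D b) w)) \<le> r * m))"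
proof -
  have r01: "0 \<le> r" "r \<le> 1/2" and Hr: "binary_entropy r = 1 - s"
    using inv_binary_entropy[of "1 - s"] s unfolding r by auto
  define k where "k m = nat \<lfloor>r * real m\<rfloor>" for m :: nat
  have k_le: "real (k m) \<le> r * m" for m using r01 by (simp add: k_def)
  have k_gt: "r * m < real (k m) + 1" for m unfolding k_def by linarith
  have k_half: "2 * k m \<le> m" for m
  proof -
    have "real (k m) \<le> 1/2 * m" using k_le[of m] r01(2) by (meson mult_right_mono of_nat_0_le_iff order_trans)
    then show ?thesis by simp
  qed
  have lim_k: "(\<lambda>m. real (k m) / real m) \<longlonglongrightarrow> r"
  proof (rule tendsto_sandwich)
    show "(\<lambda>m. r - 1 / real m) \<longlonglongrightarrow> r" by real_asymp
    show "eventually (\<lambda>m. r - 1 / real m \<le> real (k m) / real m) sequentially"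
      using eventually_gt_at_top[of 0]
    proof eventually_elim
      case (elim m)
      have "(r * m - 1) / m \<le> k m / m" using k_gt[of m] by (intro divide_right_mono) auto
      then show ?case using elim by (simp add: diff_divide_distrib)
    qed
    show "eventually (\<lambda>m. real (k m) / real m \<le> r) sequentially"
      using eventually_gt_at_top[of 0]
    proof eventually_elim
      case (elim m)
      then show ?case using k_le[of m] by (simp add: field_simps)
    qed
  qed simp
  have "(\<lambda>m. binary_entropy (real (k m) / real m)) \<longlonglongrightarrow> 1 - s"
    unfolding Hr[symmetric]
  proof (rule continuous_on_tendsto_compose[OF continuous_on_binary_entropy lim_k])
    show "r \<in> {0..1/2}" using r01 by simp
    show "eventually (\<lambda>m. real (k m) / real m \<in> {0..1/2}) sequentially"
      using eventually_gt_at_top[of 0]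
    proof eventually_elim
      case (elim m)
      then show ?case using k_half[of m] by (simp add: field_simps)
    qed
  qed
  then have "(\<lambda>m. 1 - binary_entropy (real (k m) / real m)) \<longlonglongrightarrow> 1 - (1 - s)"
    by (intro tendsto_diff tendsto_const)
  moreover have "(\<lambda>m. (log 2 (real m * (real m + 1)) + 2) / real m) \<longlonglongrightarrow> 0" by real_asymp
  ultimately have "(\<lambda>m. (1 - binary_entropy (real (k m) / real m)) +
      (log 2 (real m * (real m + 1)) + 2) / real m) \<longlonglongrightarrow> (1 - (1 - s)) + 0"
    by (rule tendsto_add)
  then have "eventually (\<lambda>m. (1 - binary_entropy (real (k m) / real m)) +
      (log 2 (real m * (real m + 1)) + 2) / real m < s + \<epsilon>) sequentially"
    using \<epsilon> by (intro order_tendstoD(2)) auto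
  moreover have "eventually (\<lambda>m. 1 / real m < \<epsilon>) sequentially"
    using \<epsilon> by real_asymp
  ultimately have "eventually (\<lambda>m. (1 - binary_entropy (real (k m) / real m)) +
      (log 2 (real m * (real m + 1)) + 2) / real m < s + \<epsilon> \<and> 1 / real m < \<epsilon> \<and> 0 < m) sequentially"
    using eventually_gt_at_top[of 0] by eventually_elim auto
  then obtain m where m: "0 < m" "1 / real m < \<epsilon>"
    "(1 - binary_entropy (real (k m) / real m)) + (log 2 (real m * (real m + 1)) + 2) / real m < s + \<epsilon>"
    using eventually_happens'[OF sequentially_bot] by blast
  \<comment> \<open>By the entropy bound, \<open>x\<close> is at least the binary logarithm of
    \<open>m * 2 ^ m / (m choose k m)\<close>, the number of codewords that the covering asks for.\<close>
  define x where "x = m * (1 - binary_entropy (real (k m) / real m)) + log 2 (real m * (real m + 1))"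
  have x: "x + 2 \<le> (s + \<epsilon>) * m"
  proof -
    have "x + 2 = ((1 - binary_entropy (real (k m) / real m)) +
        (log 2 (real m * (real m + 1)) + 2) / real m) * m"
      using m(1) by (simp add: x_def field_simps)
    also have "\<dots> \<le> (s + \<epsilon>) * m" using m(3) by (intro mult_right_mono) auto
    finally show ?thesis .
  qed
  define l where "l = nat \<lceil>x\<rceil>"
  have "real (l + 1) \<le> (s + \<epsilon>) * m"
  \<comment> \<open>For negative \<open>x\<close> the code has \<open>l = 0\<close>, and the bound \<open>1 \<le> \<epsilon> * m\<close> takes over.\<close>
  proof (cases "x \<ge> 0")
    case True
    then have "real (l + 1) \<le> x + 2" unfolding l_def by linarith
    with x show ?thesis by simp
  next
    case False
    have "1 \<le> \<epsilon> * m" using m(1,2) by (simp add: field_simps)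
    also have "\<dots> \<le> (s + \<epsilon>) * m" using s by (intro mult_right_mono) auto
    finally show ?thesis using False by (simp add: l_def)
  qed
  moreover have "real m * 2 ^ m \<le> real (m choose k m) * 2 ^ l"
  proof -
    have "x \<le> real l" unfolding l_def by linarith
    then have "2 powr x \<le> 2 powr real l" by simp
    then have 2: "2 powr x \<le> 2 ^ l" by (simp add: powr_realpow)
    have eq: "2 powr x * 2 powr (m * binary_entropy (k m / m)) = real m * (real m + 1) * 2 ^ m"
    proof -
      have "2 powr x * 2 powr (m * binary_entropy (k m / m)) =
          2 powr (real m + log 2 (real m * (real m + 1)))"
        unfolding powr_add[symmetric] x_def by (simp add: algebra_simps)
      also have "\<dots> = 2 ^ m * (real m * (real m + 1))"
        using m(1) by (simp add: powr_add powr_realpow)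
      finally show ?thesis by simp
    qed
    have "real m * (real m + 1) * 2 ^ m \<le> 2 ^ l * (real (m + 1) * real (m choose k m))"
      unfolding eq[symmetric]
      using 2 binomial_entropy_lower_bound[OF m(1) k_half] by (intro mult_mono) auto
    then have "(real m + 1) * (real m * 2 ^ m) \<le> (real m + 1) * (real (m choose k m) * 2 ^ l)"
      by (simp add: mult_ac add.commute)
    then show ?thesis by (simp add: mult_le_cancel_left)
  qed
  from covering_code[OF m(1) this] obtain D :: "bool list \<Rightarrow> bool list" where
    "\<forall>b. length (D b) = m"
    "\<forall>w. length w = m \<longrightarrow> (\<exists>b. length b = l \<and> card (errors (D b) w) = k m)" by blast
  moreover have "\<forall>w. length w = m \<longrightarrow> (\<exists>b. length b = l \<and> real (card (errors (D b) w)) \<le> r * m)"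
    using calculation(3) k_le[of m] by metis
  ultimately show ?thesis using m(1) by blast
qed

section \<open>Construction of the sequence\<close>

definition mismatches :: "(nat \<Rightarrow> bool) \<Rightarrow> bool list \<Rightarrow> nat" where
  "mismatches Y w = card {i. i < length w \<and> w ! i \<noteq> Y i}"

lemma mismatches_append:
  "mismatches Y (v @ w) =
    mismatches Y v + card (errors w (map (\<lambda>i. Y (length v + i)) [0..<length w]))"
proof -
  let ?E = "errors w (map (\<lambda>i. Y (length v + i)) [0..<length w])"
  have "{i. i < length (v @ w) \<and> (v @ w) ! i \<noteq> Y i} =
      {i. i < length v \<and> v ! i \<noteq> Y i} \<union> (+) (length v) ` ?E" (is "?A = ?B \<union> ?C")
  proof (intro equalityI subsetI)
    fix i assume i: "i \<in> ?A"
    show "i \<in> ?B \<union> ?C"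
    proof (cases "i < length v")
      case True
      then show ?thesis using i by (simp add: nth_append)
    next
      case False
      then have "i - length v \<in> ?E" "i = length v + (i - length v)"
        using i by (auto simp: errors_def nth_append)
      then show ?thesis by blast
    qed
  qed (auto simp: errors_def nth_append)
  moreover have "card (?B \<union> ?C) = card ?B + card ?C"
    by (intro card_Un_disjoint) (auto simp: errors_def)
  moreover have "card ?C = card ?E" by (intro card_image) simp
  ultimately show ?thesis by (simp add: mismatches_def)
qed

lemma mismatches_append_le: "mismatches Y (v @ w) \<le> mismatches Y v + length w"
proof -
  have "errors w u \<subseteq> {..<length w}" for u by (auto simp: errors_def)
  from card_mono[OF _ this] show ?thesis by (simp add: mismatches_append)
qed

lemma hamming_dist_initial_segment:
  "hamming_dist (initial_segment X n) (initial_segment Y n) = mismatches Y (initial_segment X n) / n"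
proof -
  have "{k. k < n \<and> map X [0..<n] ! k \<noteq> map Y [0..<n] ! k} = {k. k < n \<and> map X [0..<n] ! k \<noteq> Y k}"
    by auto
  then show ?thesis by (simp add: hamming_dist_def mismatches_def initial_segment_def)
qed

text \<open>The next block of \<open>Y\<close> is replaced by a codeword with at most \<open>r * m\<close> errors. Inside a block
  only the trivial bound \<open>m\<close> on the number of errors is available, which is the additive term
  for intermediate prefixes.\<close>

lemma approximation_by_blocks:
  fixes D :: "bool list \<Rightarrow> bool list" and r :: real
  assumes "0 \<le> r" and D: "\<And>b. length (D b) = m"
    and cover: "\<And>w. length w = m \<Longrightarrow> \<exists>b. length b = l \<and> real (card (errors (D b) w)) \<le> r * m"
    and \<sigma>: "real (mismatches Y \<sigma>) \<le> r * length \<sigma>"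
  shows "\<exists>bs. length bs = t \<and> (\<forall>b\<in>set bs. length b = l) \<and>
    length (concat (map D bs)) = t * m \<and>
    real (mismatches Y (\<sigma> @ concat (map D bs))) \<le> r * (length \<sigma> + t * m) \<and>
    (\<forall>n. length \<sigma> \<le> n \<longrightarrow> n \<le> length \<sigma> + t * m \<longrightarrow>
      real (mismatches Y (take n (\<sigma> @ concat (map D bs)))) \<le> r * n + m)"
proof (induction t)
  case 0
  show ?case by (rule exI[of _ "[]"]) (use \<sigma> in auto)
next
  case (Suc t)
  then obtain bs where bs: "length bs = t" "\<forall>b\<in>set bs. length b = l"
    "length (concat (map D bs)) = t * m"
    "real (mismatches Y (\<sigma> @ concat (map D bs))) \<le> r * (length \<sigma> + t * m)"
    "\<And>n. length \<sigma> \<le> n \<Longrightarrow> n \<le> length \<sigma> + t * m \<Longrightarrow>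
      real (mismatches Y (take n (\<sigma> @ concat (map D bs)))) \<le> r * n + m" by blast
  define v where "v = \<sigma> @ concat (map D bs)"
  have v: "length v = length \<sigma> + t * m" using bs(3) by (simp add: v_def)
  obtain b where b: "length b = l"
    "real (card (errors (D b) (map (\<lambda>i. Y (length v + i)) [0..<m]))) \<le> r * m"
    using cover[of "map (\<lambda>i. Y (length v + i)) [0..<m]"] by auto
  have app: "\<sigma> @ concat (map D (bs @ [b])) = v @ D b" by (simp add: v_def)
  have "real (mismatches Y (v @ D b)) \<le> r * (length \<sigma> + Suc t * m)"
  proof -
    have "real (mismatches Y (v @ D b)) \<le> real (mismatches Y v) + r * m"
      using b(2) by (simp add: mismatches_append D)
    also have "\<dots> \<le> r * (length \<sigma> + t * m) + r * m" using bs(4) by (simp add: v_def)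
    finally show ?thesis by (simp add: algebra_simps)
  qed
  moreover have "real (mismatches Y (take n (v @ D b))) \<le> r * n + m"
    if n: "length \<sigma> \<le> n" "n \<le> length \<sigma> + Suc t * m" for n
  proof (cases "n \<le> length v")
    case True
    then show ?thesis using bs(5)[of n] n v by (simp add: v_def)
  next
    case False
    have "real (mismatches Y (take n (v @ D b))) \<le> real (mismatches Y v) + length (take (n - length v) (D b))"
      using False mismatches_append_le[of Y v "take (n - length v) (D b)"]
      by (simp del: length_take flip: of_nat_add)
    also have "\<dots> \<le> r * length v + m" using bs(4) v D[of b] by (simp add: v_def)
    also have "\<dots> \<le> r * n + m" using False \<open>0 \<le> r\<close> by (simp add: mult_left_mono)
    finally show ?thesis .
  qed
  ultimately show ?case
    using bs b(1) D by (intro exI[of _ "bs @ [b]"]) (simp add: app del: map_append concat_append, simp)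
qed

text \<open>Appending more blocks makes every fixed cost negligible: both the constant \<open>c\<close> of the
  machine for \<open>\<sigma>\<close> and the length \<open>N\<close> that the next stage requires.\<close>

lemma extension_stage:
  fixes D :: "bool list \<Rightarrow> bool list" and r a \<epsilon> :: real
  assumes U: "optimal_prefix_free_machine U" and "0 \<le> r" and "0 < m" and "0 < \<epsilon>"
    and D: "\<And>b. length (D b) = m"
    and cover: "\<And>w. length w = m \<Longrightarrow> \<exists>b. length b = l \<and> real (card (errors (D b) w)) \<le> r * m"
    and rate: "real (l + 1) \<le> a * m" and "0 \<le> a"
    and \<sigma>: "real (mismatches Y \<sigma>) \<le> r * length \<sigma>"
  shows "\<exists>\<sigma>'. prefix \<sigma> \<sigma>' \<and> length \<sigma> < length \<sigma>' \<and> N \<le> length \<sigma>' \<and>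
    real (mismatches Y \<sigma>') \<le> r * length \<sigma>' \<and>
    (\<forall>n. length \<sigma> \<le> n \<longrightarrow> n \<le> length \<sigma>' \<longrightarrow> real (mismatches Y (take n \<sigma>')) \<le> r * n + m) \<and>
    ereal_of_enat (complexity U \<sigma>') \<le> ereal ((a + \<epsilon>) * length \<sigma>')"
proof -
  obtain c where c: "\<And>bs. \<forall>b\<in>set bs. length b = l \<Longrightarrow>
      complexity U (\<sigma> @ concat (map D bs)) \<le> enat (length bs * (l + 1) + c)"
    using complexity_block_code[where D = D and m = m, OF U D] by blast
  define t where "t = nat \<lceil>c / \<epsilon>\<rceil> + N + 1"
  obtain bs where bs: "length bs = t" "\<forall>b\<in>set bs. length b = l"
    "length (concat (map D bs)) = t * m"
    "real (mismatches Y (\<sigma> @ concat (map D bs))) \<le> r * (length \<sigma> + t * m)"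
    "\<And>n. length \<sigma> \<le> n \<Longrightarrow> n \<le> length \<sigma> + t * m \<Longrightarrow>
      real (mismatches Y (take n (\<sigma> @ concat (map D bs)))) \<le> r * n + m"
    using approximation_by_blocks[OF \<open>0 \<le> r\<close> D cover \<sigma>, of t] by blast
  let ?\<sigma>' = "\<sigma> @ concat (map D bs)"
  have len: "length ?\<sigma>' = length \<sigma> + t * m" using bs(3) by simp
  have tm: "t \<le> t * m" using \<open>0 < m\<close> by simp
  have "c / \<epsilon> \<le> real t" unfolding t_def by linarith
  then have "real c \<le> \<epsilon> * t" using \<open>0 < \<epsilon>\<close> by (simp add: field_simps)
  also have "\<dots> \<le> \<epsilon> * (t * m)" using tm \<open>0 < \<epsilon>\<close> by (intro mult_left_mono) (simp_all flip: of_nat_mult)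
  finally have "real (t * (l + 1) + c) \<le> t * (a * m) + \<epsilon> * (t * m)"
    using mult_left_mono[OF rate, of "real t"] by (simp add: distrib_left)
  also have "\<dots> = (a + \<epsilon>) * (t * m)" by (simp add: algebra_simps)
  also have "\<dots> \<le> (a + \<epsilon>) * length ?\<sigma>'"
    unfolding len using \<open>0 \<le> a\<close> \<open>0 < \<epsilon>\<close> by (intro mult_left_mono) auto
  finally have "ereal (real (t * (l + 1) + c)) \<le> ereal ((a + \<epsilon>) * length ?\<sigma>')" by simp
  moreover have "ereal_of_enat (complexity U ?\<sigma>') \<le> ereal_of_enat (enat (t * (l + 1) + c))"
    using c[OF bs(2)] bs(1) unfolding ereal_of_enat_le_iff by simp
  ultimately have "ereal_of_enat (complexity U ?\<sigma>') \<le> ereal ((a + \<epsilon>) * length ?\<sigma>')"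
    by (simp only: ereal_of_enat_simps)
  moreover have "length \<sigma> < length ?\<sigma>'" "N \<le> length ?\<sigma>'"
    using tm unfolding len t_def by linarith+
  moreover have "real (mismatches Y ?\<sigma>') \<le> r * length ?\<sigma>'"
    using bs(4) unfolding len by simp
  moreover have "\<forall>n. length \<sigma> \<le> n \<longrightarrow> n \<le> length ?\<sigma>' \<longrightarrow> real (mismatches Y (take n ?\<sigma>')) \<le> r * n + m"
    using bs(5) unfolding len by blast
  ultimately show ?thesis by (intro exI[of _ ?\<sigma>'] conjI prefixI[OF refl])
qed

lemma limit_of_prefix_chain:
  fixes f :: "nat \<Rightarrow> bool list"
  assumes "\<And>k. prefix (f k) (f (Suc k))" and "\<And>k. length (f k) < length (f (Suc k))"
  shows "\<exists>X. \<forall>k. \<forall>n\<le>length (f k). initial_segment X n = take n (f k)"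
proof (intro exI allI impI)
  fix k n assume n: "n \<le> length (f k)"
  have mono: "prefix (f i) (f j)" if "i \<le> j" for i j
    using that by (induction rule: dec_induct) (use assms(1) prefix_order.trans in blast)+
  have len: "i \<le> length (f i)" for i
  proof (induction i)
    case (Suc i) then show ?case using assms(2)[of i] by simp
  qed simp
  \<comment> \<open>Bit \<open>i\<close> can be read off \<open>f (Suc i)\<close>, which has length at least \<open>Suc i\<close>.\<close>
  show "initial_segment (\<lambda>i. f (Suc i) ! i) n = take n (f k)"
  proof (rule nth_equalityI)
    fix i assume "i < length (initial_segment (\<lambda>i. f (Suc i) ! i) n)"
    then have i: "i < n" by (simp add: initial_segment_def)
    have "f (Suc i) ! i = f k ! i"
      using mono[of "Suc i" k] mono[of k "Suc i"] len[of "Suc i"] i n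
      by (cases "Suc i \<le> k") (auto simp: prefix_def nth_append)
    then show "initial_segment (\<lambda>i. f (Suc i) ! i) n ! i = take n (f k) ! i"
      using i by (simp add: initial_segment_def)
  qed (use n in \<open>simp add: initial_segment_def\<close>)
qed

theorem theorem3p3:
  fixes U :: "bool list \<Rightarrow> bool list option" and s :: real and Y :: "nat \<Rightarrow> bool"
  assumes "optimal_prefix_free_machine U"
    and "s \<in> {0..1}"
  shows "\<exists>X :: nat \<Rightarrow> bool. effective_dim U X \<le> ereal s \<and>
    seq_dist X Y \<le> ereal (inv_binary_entropy (1 - s))"
proof -
  define r where "r = inv_binary_entropy (1 - s)"
  have r: "0 \<le> r" using inv_binary_entropy(1)[of "1 - s"] assms(2) by (simp add: r_def)
  define \<epsilon> where "\<epsilon> k = 1 / real (Suc k)" for k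
  have \<epsilon>: "0 < \<epsilon> k" "0 \<le> s + \<epsilon> k" for k using assms(2) by (auto simp: \<epsilon>_def)
  have "\<forall>k. \<exists>m l (D :: bool list \<Rightarrow> bool list).
    0 < m \<and> real (l + 1) \<le> (s + \<epsilon> k) * m \<and> (\<forall>b. length (D b) = m) \<and>
    (\<forall>w. length w = m \<longrightarrow> (\<exists>b. length b = l \<and> real (card (errors (D b) w)) \<le> r * m))"
    using good_covering_code[OF assms(2) r_def \<epsilon>(1)] by blast
  then obtain m l and D :: "nat \<Rightarrow> bool list \<Rightarrow> bool list" where
    m: "\<And>k. 0 < m k" and rate: "\<And>k. real (l k + 1) \<le> (s + \<epsilon> k) * m k"
    and D: "\<And>k b. length (D k b) = m k"
    and cover: "\<And>k w. length w = m k \<Longrightarrow>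
      \<exists>b. length b = l k \<and> real (card (errors (D k b) w)) \<le> r * m k" by metis
  \<comment> \<open>\<open>P k\<close> holds at the start of stage \<open>k\<close>, which uses blocks of length \<open>m k\<close>; \<open>Q k\<close> relates
    its start to its end.\<close>
  define P where "P k \<sigma> \<longleftrightarrow> real (mismatches Y \<sigma>) \<le> r * length \<sigma> \<and> k * m k \<le> length \<sigma>"
    for k \<sigma>
  define Q where "Q k \<sigma> \<sigma>' \<longleftrightarrow> prefix \<sigma> \<sigma>' \<and> length \<sigma> < length \<sigma>' \<and>
    (\<forall>n. length \<sigma> \<le> n \<longrightarrow> n \<le> length \<sigma>' \<longrightarrow> real (mismatches Y (take n \<sigma>')) \<le> r * n + m k) \<and>
    ereal_of_enat (complexity U \<sigma>') \<le> ereal ((s + \<epsilon> k + \<epsilon> k) * length \<sigma>')" for k \<sigma> \<sigma>'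
  have "\<exists>f. \<forall>k. P k (f k) \<and> Q k (f k) (f (Suc k))"
  proof (rule dependent_nat_choice)
    show "\<exists>\<sigma>. P 0 \<sigma>" by (rule exI[of _ "[]"]) (simp add: P_def mismatches_def)
  next
    fix \<sigma> k assume "P k \<sigma>"
    then have \<sigma>: "real (mismatches Y \<sigma>) \<le> r * length \<sigma>" by (simp add: P_def)
    show "\<exists>\<sigma>'. P (Suc k) \<sigma>' \<and> Q k \<sigma> \<sigma>'"
      using extension_stage[where D = "D k" and m = "m k" and l = "l k" and \<epsilon> = "\<epsilon> k",
          OF assms(1) r m \<epsilon>(1) D cover rate \<epsilon>(2) \<sigma>, of "Suc k * m (Suc k)"]
      unfolding P_def Q_def by blast
  qed
  then obtain f where P: "\<And>k. P k (f k)" and Q: "\<And>k. Q k (f k) (f (Suc k))" by blast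
  have len: "length (f k) < length (f (Suc k))" for k using Q by (simp add: Q_def)
  then have mono: "strict_mono (\<lambda>k. length (f k))" by (simp add: strict_mono_Suc_iff)
  obtain X where X: "\<And>k n. n \<le> length (f k) \<Longrightarrow> initial_segment X n = take n (f k)"
    using limit_of_prefix_chain[of f] len Q unfolding Q_def by blast
  have "effective_dim U X \<le> ereal s"
  proof -
    define g where "g n = ereal_of_enat (complexity U (initial_segment X n)) / ereal (real n)" for n
    define h where "h k = length (f (Suc k))" for k
    have "strict_mono h" unfolding h_def using len by (simp add: strict_mono_Suc_iff)
    have "(g \<circ> h) k \<le> ereal (s + \<epsilon> k + \<epsilon> k)" for k
    proof -
      have h: "0 < h k" using len[of k] unfolding h_def by linarith
      have "(g \<circ> h) k = ereal_of_enat (complexity U (f (Suc k))) / ereal (h k)"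
        using X[of "h k" "Suc k"] by (simp add: g_def h_def)
      also have "\<dots> \<le> ereal ((s + \<epsilon> k + \<epsilon> k) * h k) / ereal (h k)"
        using Q[of k] h by (intro ereal_divide_right_mono) (auto simp: Q_def h_def)
      also have "\<dots> = ereal (s + \<epsilon> k + \<epsilon> k)" using h by simp
      finally show ?thesis .
    qed
    then have "liminf (g \<circ> h) \<le> liminf (\<lambda>k. ereal (s + \<epsilon> k + \<epsilon> k))"
      by (intro Liminf_mono always_eventually allI)
    also have "\<dots> = ereal s"
    proof (rule lim_imp_Liminf)
      have "\<epsilon> \<longlonglongrightarrow> 0" unfolding \<epsilon>_def by (rule LIMSEQ_Suc[OF lim_1_over_n])
      then have "(\<lambda>k. s + \<epsilon> k + \<epsilon> k) \<longlonglongrightarrow> s + 0 + 0" by (intro tendsto_intros)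
      then show "(\<lambda>k. ereal (s + \<epsilon> k + \<epsilon> k)) \<longlonglongrightarrow> ereal s" by simp
    qed simp
    finally have "liminf (g \<circ> h) \<le> ereal s" .
    moreover have "effective_dim U X = liminf g" by (simp add: effective_dim_def g_def[abs_def])
    ultimately show ?thesis using liminf_subseq_mono[OF \<open>strict_mono h\<close>, of g] by simp
  qed
  moreover have "seq_dist X Y \<le> ereal r"
  proof (rule ereal_le_epsilon2)
    fix e :: real assume "0 < e"
    then obtain K where K: "0 < K" "inverse (real K) < e" 
      by (metis reals_Archimedean zero_less_Suc)
    have "hamming_dist (initial_segment X n) (initial_segment Y n) \<le> r + e"
      if n: "length (f K) \<le> n" for n
    proof -
      have "\<exists>k. n < length (f k)"
        using seq_suble[OF mono, of "Suc n"] by (intro exI[of _ "Suc n"]) simp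
      then obtain j where "n < length (f j)" by blast
      moreover have "\<not> n < length (f 0)"
        using n strict_mono_less_eq[OF mono, of 0 K] by simp
      ultimately obtain k where k: "\<not> n < length (f k)" "n < length (f (Suc k))"
        using ex_least_nat_less[of "\<lambda>k. n < length (f k)"] by blast
      have "K \<le> k"
      proof (rule ccontr)
        assume "\<not> K \<le> k"
        then have "Suc k \<le> K" by simp
        then have "length (f (Suc k)) \<le> length (f K)"
          using strict_mono_less_eq[OF mono] by blast
        then show False using n k by simp
      qed
      have "0 < length (f K)" using seq_suble[OF mono, of K] K by linarith
      then have "0 < n" using n by linarith
      have "real (m k) \<le> e * n"
      proof -
        \<comment> \<open>A partial block of stage \<open>k\<close> is short compared with the start of the stage.\<close>
        have "K * m k \<le> k * m k" using \<open>K \<le> k\<close> by simp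
        also have "\<dots> \<le> length (f k)" using P[of k] by (simp add: P_def)
        finally have "K * m k \<le> n" using k by simp
        then have "real K * real (m k) \<le> real n" by (simp flip: of_nat_mult)
        then have "real (m k) \<le> inverse (real K) * n" using K by (simp add: field_simps)
        also have "\<dots> \<le> e * n" using K by (intro mult_right_mono) auto
        finally show ?thesis .
      qed
      moreover have "real (mismatches Y (initial_segment X n)) \<le> r * n + m k"
        using Q[of k] k X[of n "Suc k"] by (simp add: Q_def)
      ultimately have "real (mismatches Y (initial_segment X n)) \<le> (r + e) * n"
        by (simp add: algebra_simps)
      then show ?thesis using \<open>0 < n\<close> by (simp add: hamming_dist_initial_segment divide_le_eq)
    qed
    then show "seq_dist X Y \<le> ereal r + ereal e"
      unfolding seq_dist_def by (intro Limsup_bounded eventually_sequentiallyI[of "length (f K)"]) simp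
  qed
  ultimately show ?thesis unfolding r_def by blast
qed

end
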